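(* Let $H^m:\mathbb{R}^d\to\mathbb{R}^s$ and $H^v:\mathbb{R}^d\to\mathbb{R}^{s^2}$ be the quadratic and cubic observation functions defined in the context (with $H^v$ stretched into a vector), and let $\Gamma_m\in\mathbb{R}^{s\times s}$, $\Gamma_v\in\mathbb{R}^{s^2\times s^2}$ be symmetric invertible matrices. Let $Z$ be an $\mathbb{R}^d$-valued random variable with law $\tilde\rho$, let $\tilde{\mathbb{E}}$ denote expectation with respect to $\tilde\rho$, and assume $\tilde{\mathbb{E}}|H^m(Z)|^2<\infty$ and $\tilde{\mathbb{E}}|H^v(Z)|^2<\infty$. Set $\bar H^m=\tilde{\mathbb{E}}[H^m(Z)]$ and $\bar H^v=\tilde{\mathbb{E}}[H^v(Z)]$, and define the gain operators $K^m(Z)\in\mathbb{R}^{d\times s}$ and $K^v(Z)\in\mathbb{R}^{d\times s^2}$ by $$K^m(Z)=\tfrac12 Z\,[H^m(Z)-\bar H^m]^T\Gamma_m^{-2},\qquad K^v(Z)=\tfrac13 Z\,[H^v(Z)-\bar H^v]^T\Gamma_v^{-2}.$$ Then both satisfy the gain equation $$\tilde{\mathbb{E}}\big[(K^m)^T\nabla H^m\big]=\Gamma_m^{-2}C^{H^m},\qquad \tilde{\mathbb{E}}\big[(K^v)^T\nabla H^v\big]=\Gamma_v^{-2}C^{H^v},$$ where $C^{H}=\tilde{\mathbb{E}}\big[(H(Z)-\bar H)(H(Z)-\bar H)^T\big]$ for $H=H^m$ or $H=H^v$.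
   Context: Fix $1\le s\le d$, an orthonormal basis $\{\hat v_k\}_{k=1}^d$ of $\mathbb{R}^d$, and a bilinear map $B:\mathbb{R}^d\times\mathbb{R}^d\to\mathbb{R}^d$ with $u\cdot B(u,u)=0$ for all $u$. Put $\gamma_{kpq}=\hat v_k\cdot B(\hat v_p,\hat v_q)$. For $z\in\mathbb{R}^d$ and $1\le k,l\le s$ the observation functions are $$H^m_k(z)=\sum_{p,q=1}^d\gamma_{kpq}z_pz_q,\qquad H^v_{kl}(z)=\sum_{p,q=1}^d\big(\gamma_{kpq}z_pz_qz_l+\gamma_{lpq}z_pz_qz_k\big).$$ The $s\times s$ array $H^v$ is regarded as a vector in $\mathbb{R}^{s^2}$ indexed by pairs $(k,l)$. For a vector-valued function $H$ on $\mathbb{R}^d$, $\nabla H$ is the matrix with entries $(\nabla H)_{jk}=\partial_{z_j}H_k$ (so $\nabla H^m\in\mathbb{R}^{d\times s}$, $\nabla H^v\in\mathbb{R}^{d\times s^2}$). In the gain equations, $\nabla H$ is evaluated at $Z$. $\Gamma^{-2}$ means $(\Gamma^{-1})^2$. *)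

theory Defs
  imports "HOL-Probability.Probability"
begin

(* The index sets {1..d} and {1..s} are the finite types 'd and 's; an injection e :: 's => 'd
   plays the role of the inclusion {1..s} <= {1..d}, so it carries the hypothesis s <= d.
   Only membership in {1..s} matters, never the order of the indices. *)

definition orthonormal_basis :: "('d::finite \<Rightarrow> real^'d) \<Rightarrow> bool" where
  "orthonormal_basis v \<longleftrightarrow>
     (\<forall>i j. v i \<bullet> v j = (if i = j then 1 else 0)) \<and> span (range v) = UNIV"

definition triad :: "(real^'d \<Rightarrow> real^'d \<Rightarrow> real^'d) \<Rightarrow> ('d::finite \<Rightarrow> real^'d)
    \<Rightarrow> 'd \<Rightarrow> 'd \<Rightarrow> 'd \<Rightarrow> real" where
  "triad B v k p q = v k \<bullet> B (v p) (v q)"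

definition obs_mean :: "(real^'d \<Rightarrow> real^'d \<Rightarrow> real^'d) \<Rightarrow> ('d::finite \<Rightarrow> real^'d)
    \<Rightarrow> ('s::finite \<Rightarrow> 'd) \<Rightarrow> real^'d \<Rightarrow> real^'s" where
  "obs_mean B v e z =
     (\<chi> k. \<Sum>p\<in>UNIV. \<Sum>q\<in>UNIV. triad B v (e k) p q * z $ p * z $ q)"

definition obs_var :: "(real^'d \<Rightarrow> real^'d \<Rightarrow> real^'d) \<Rightarrow> ('d::finite \<Rightarrow> real^'d)
    \<Rightarrow> ('s::finite \<Rightarrow> 'd) \<Rightarrow> real^'d \<Rightarrow> real^('s \<times> 's)" where
  "obs_var B v e z =
     (\<chi> kl. \<Sum>p\<in>UNIV. \<Sum>q\<in>UNIV.
        triad B v (e (fst kl)) p q * z $ p * z $ q * z $ e (snd kl) +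
        triad B v (e (snd kl)) p q * z $ p * z $ q * z $ e (fst kl))"

(* The transpose of the Jacobian: the row index is the differentiation variable. *)
definition grad :: "(real^'d \<Rightarrow> real^'n) \<Rightarrow> real^'d \<Rightarrow> real^'n^'d::finite" where
  "grad H z = (\<chi> j k. deriv (\<lambda>t. H (z + t *\<^sub>R axis j 1) $ k) 0)"

definition outer :: "real^'m \<Rightarrow> real^'n \<Rightarrow> real^'n^'m" where
  "outer x y = (columnvector x :: real^1^'m) ** (rowvector y :: real^'n^1)"

definition expect :: "'a measure \<Rightarrow> ('a \<Rightarrow> 'b::{banach, second_countable_topology}) \<Rightarrow> 'b" where
  "expect \<rho> f = (\<integral>z. f z \<partial>\<rho>)"

definition cov :: "(real^'d) measure \<Rightarrow> (real^'d \<Rightarrow> real^'n) \<Rightarrow> real^'n^'n" where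
  "cov \<rho> H = expect \<rho> (\<lambda>z. outer (H z - expect \<rho> H) (H z - expect \<rho> H))"

definition inv_sq :: "real^'n^'n \<Rightarrow> real^'n^'n" where
  "inv_sq \<Gamma> = matrix_inv \<Gamma> ** matrix_inv \<Gamma>"

definition gain :: "real \<Rightarrow> (real^'d) measure \<Rightarrow> (real^'d \<Rightarrow> real^'n) \<Rightarrow> real^'n^'n
    \<Rightarrow> real^'d \<Rightarrow> real^'n^'d" where
  "gain c \<rho> H \<Gamma> z = c *\<^sub>R (outer z (H z - expect \<rho> H) ** inv_sq \<Gamma>)"

end

theory Submission
  imports Defs
begin

text \<open>
  Both observation functions are homogeneous, \<open>H\<^sup>m\<close> of degree 2 and \<open>H\<^sup>v\<close> of degree 3, so Euler's
  identity \<open>z\<^sup>T \<nabla>H(z) = n H(z)\<close> collapses the product of the gain with \<open>\<nabla>H\<close> to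
  \<open>\<Gamma>\<^sup>-\<^sup>2 (H - E H) H\<^sup>T\<close>. Because \<open>H - E H\<close> has mean zero, the last factor may be centred
  under the expectation, which leaves \<open>\<Gamma>\<^sup>-\<^sup>2\<close> times the covariance.
\<close>

lemma outer_nth: "outer x y $ i $ j = x $ i * y $ j"
  by (simp add: outer_def matrix_matrix_mult_def columnvector_def rowvector_def)

text \<open>In finite dimension bilinearity implies boundedness, so checking linearity entrywise in
  each argument suffices. The bounded form supplies both the norm estimate and the exchange with
  integrals.\<close>

lemma bounded_bilinear_outer:
  "bounded_bilinear (outer :: real^'m \<Rightarrow> real^'n \<Rightarrow> real^'n^'m)"
  unfolding bilinear_conv_bounded_bilinear[symmetric] bilinear_def
  by (auto intro!: linearI simp: vec_eq_iff outer_nth algebra_simps)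

lemma bounded_linear_matrix_mult:
  fixes A :: "real^'n^'m"
  shows "bounded_linear (\<lambda>X :: real^'k^'n. A ** X)"
  unfolding linear_conv_bounded_linear[symmetric]
  by (auto intro!: linearI simp: matrix_add_ldistrib matrix_scalar_ac scalar_matrix_assoc)

text \<open>Transposing \<open>\<Gamma> ** matrix_inv \<Gamma> = mat 1\<close> makes the transposed
  inverse a left inverse of the symmetric \<open>\<Gamma>\<close>, and a left inverse agrees with
  the right inverse.\<close>

lemma transpose_inv_sq:
  fixes \<Gamma> :: "real^'n^'n"
  assumes "transpose \<Gamma> = \<Gamma>" "invertible \<Gamma>"
  shows "transpose (inv_sq \<Gamma>) = inv_sq \<Gamma>"
proof -
  have inv: "\<Gamma> ** matrix_inv \<Gamma> = mat 1" "matrix_inv \<Gamma> ** \<Gamma> = mat 1"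
    using someI_ex[OF assms(2)[unfolded invertible_def]] by (simp_all add: matrix_inv_def)
  have "transpose (matrix_inv \<Gamma>) ** \<Gamma> = mat 1"
    using inv(1) assms(1) by (metis matrix_transpose_mul transpose_mat)
  then have "transpose (matrix_inv \<Gamma>) = matrix_inv \<Gamma>"
    using inv(1) by (metis matrix_mul_assoc matrix_mul_lid matrix_mul_rid)
  then show ?thesis
    by (simp add: inv_sq_def matrix_transpose_mul)
qed

text \<open>The map \<open>t \<mapsto> H (t *\<^sub>R z)\<close> is differentiated at 1 in two ways:
  the chain rule gives the derivative of \<open>H\<close> at \<open>z\<close> in direction
  \<open>z\<close>, and homogeneity gives \<open>n\<close> times \<open>H z\<close>.\<close>

lemma euler_identity:
  fixes H :: "real^'d \<Rightarrow> real^'n"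
  assumes diff: "H differentiable (at z)"
    and hom: "\<And>t. H (t *\<^sub>R z) = t ^ n *\<^sub>R H z"
  shows "(\<Sum>j\<in>UNIV. z $ j * grad H z $ j $ k) = real n * H z $ k"
proof -
  obtain D where D: "(H has_derivative D) (at z)"
    using diff by (auto simp: differentiable_def)
  define E where "E = (\<lambda>h. D h $ k)"
  have E: "((\<lambda>x. H x $ k) has_derivative E) (at z)"
    unfolding E_def using D by (rule bounded_linear.has_derivative[OF bounded_linear_vec_nth])
  have lin: "linear E"
    using E has_derivative_linear by blast
  \<comment> \<open>One chain rule along lines covers both uses: coordinate lines that meet
    \<open>z\<close> at parameter 0, and the ray from the origin that meets \<open>z\<close> at
    parameter 1.\<close>
  have dir: "((\<lambda>t. H (a + t *\<^sub>R h) $ k) has_field_derivative E h) (at u)"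
    if "a + u *\<^sub>R h = z" for a h u
  proof -
    have line: "((\<lambda>t. a + t *\<^sub>R h) has_derivative (\<lambda>t. t *\<^sub>R h)) (at u)"
      by (auto intro!: derivative_eq_intros)
    have "((\<lambda>t. H (a + t *\<^sub>R h) $ k) has_derivative (\<lambda>t. E (t *\<^sub>R h))) (at u)"
      using has_derivative_compose[OF line, of "\<lambda>x. H x $ k" E] E that by simp
    then show ?thesis
      by (simp add: has_field_derivative_def linear_scale[OF lin] mult_commute_abs)
  qed
  have "grad H z $ j $ k = E (axis j 1)" for j
    using DERIV_imp_deriv[OF dir[of z 0 "axis j 1"]] by (simp add: grad_def)
  then have "(\<Sum>j\<in>UNIV. z $ j * grad H z $ j $ k) = (\<Sum>j\<in>UNIV. E (z $ j *\<^sub>R axis j 1))"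
    by (simp add: linear_scale[OF lin])
  also have "\<dots> = E (\<Sum>j\<in>UNIV. z $ j *\<^sub>R axis j 1)"
    by (simp add: linear_sum[OF lin])
  also have "(\<Sum>j\<in>UNIV. z $ j *\<^sub>R axis j 1) = z"
    using basis_expansion[of z] by (simp add: scalar_mult_eq_scaleR)
  also have "E z = real n * H z $ k"
  proof (rule DERIV_unique)
    show "((\<lambda>t. H (0 + t *\<^sub>R z) $ k) has_field_derivative E z) (at 1)"
      by (rule dir) simp
    show "((\<lambda>t. H (0 + t *\<^sub>R z) $ k) has_field_derivative real n * H z $ k) (at 1)"
      by (auto simp: hom intro!: derivative_eq_intros)
  qed
  finally show ?thesis .
qed

text \<open>Transposition moves the symmetric weight to the left and brings \<open>z\<close> next to
  the gradient. Euler's identity then produces the degree \<open>n\<close>, which \<open>c\<close>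
  cancels.\<close>

lemma transpose_gain_grad:
  fixes H :: "real^'d \<Rightarrow> real^'n"
  assumes "transpose \<Gamma> = \<Gamma>" "invertible \<Gamma>"
    and "H differentiable (at z)"
    and "\<And>t. H (t *\<^sub>R z) = t ^ n *\<^sub>R H z"
    and "c * real n = 1"
  shows "transpose (gain c \<rho> H \<Gamma> z) ** grad H z
    = inv_sq \<Gamma> ** outer (H z - expect \<rho> H) (H z)"
proof -
  let ?X = "H z - expect \<rho> H"
  have "transpose (outer z ?X) ** grad H z = real n *\<^sub>R outer ?X (H z)"
  proof (simp add: vec_eq_iff, intro allI)
    fix k i
    have "(transpose (outer z ?X) ** grad H z) $ k $ i
        = ?X $ k * (\<Sum>j\<in>UNIV. z $ j * grad H z $ j $ i)"
      by (simp add: matrix_matrix_mult_def transpose_def outer_nth sum_distrib_left mult_ac)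
    then show "(transpose (outer z ?X) ** grad H z) $ k $ i = real n * outer ?X (H z) $ k $ i"
      using euler_identity[OF assms(3,4)] by (simp add: outer_nth)
  qed
  moreover have "transpose (gain c \<rho> H \<Gamma> z)
      = c *\<^sub>R (inv_sq \<Gamma> ** transpose (outer z ?X))"
    by (simp add: gain_def transpose_scalar matrix_transpose_mul transpose_inv_sq[OF assms(1,2)])
  ultimately show ?thesis
    using \<open>c * real n = 1\<close>
    by (simp add: scalar_matrix_assoc[symmetric] matrix_mul_assoc[symmetric] matrix_scalar_ac)
qed

text \<open>The norm of the outer product is at most a constant times the product of the norms,
  which the sum of the squared norms dominates.\<close>

lemma integrable_outer:
  fixes f :: "'a \<Rightarrow> real^'m" and g :: "'a \<Rightarrow> real^'n"
  assumes f: "f \<in> borel_measurable M" and g: "g \<in> borel_measurable M"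
    and f2: "integrable M (\<lambda>x. (norm (f x))\<^sup>2)" and g2: "integrable M (\<lambda>x. (norm (g x))\<^sup>2)"
  shows "integrable M (\<lambda>x. outer (f x) (g x))"
proof -
  obtain K where K: "0 < K" "\<And>(a::real^'m) (b::real^'n). norm (outer a b) \<le> norm a * norm b * K"
    using bounded_bilinear.pos_bounded[OF bounded_bilinear_outer] by blast
  show ?thesis
  proof (rule Bochner_Integration.integrable_bound)
    show "integrable M (\<lambda>x. K * ((norm (f x))\<^sup>2 + (norm (g x))\<^sup>2))"
      using f2 g2 by simp
    have "continuous_on UNIV (\<lambda>p :: (real^'m) \<times> (real^'n). outer (fst p) (snd p))"
      by (intro bounded_bilinear.continuous_on[OF bounded_bilinear_outer] continuous_intros)
    then show "(\<lambda>x. outer (f x) (g x)) \<in> borel_measurable M"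
      by (rule borel_measurable_continuous_Pair[OF f g])
    have "norm (outer (f x) (g x)) \<le> norm (K * ((norm (f x))\<^sup>2 + (norm (g x))\<^sup>2))" for x
    proof -
      \<comment> \<open>The square inequality bounds twice the product; nonnegativity of the product
        allows the factor 2 to be dropped.\<close>
      have "norm (f x) * norm (g x) \<le> (norm (f x))\<^sup>2 + (norm (g x))\<^sup>2"
        using sum_squares_bound[of "norm (f x)" "norm (g x)"]
          mult_nonneg_nonneg[OF norm_ge_zero[of "f x"] norm_ge_zero[of "g x"]] by linarith
      then have "norm (f x) * norm (g x) * K \<le> ((norm (f x))\<^sup>2 + (norm (g x))\<^sup>2) * K"
        using K(1) by (intro mult_right_mono) auto
      then have "norm (outer (f x) (g x)) \<le> K * ((norm (f x))\<^sup>2 + (norm (g x))\<^sup>2)"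
        using K(2)[of "f x" "g x"] by (simp only: mult.commute[of K])
      then show ?thesis
        using order_trans[OF _ abs_ge_self] by (simp only: real_norm_def)
    qed
    then show "AE x in M. norm (outer (f x) (g x)) \<le> norm (K * ((norm (f x))\<^sup>2 + (norm (g x))\<^sup>2))"
      by simp
  qed
qed

lemma (in prob_space) integrable_of_square_integrable:
  fixes f :: "'a \<Rightarrow> 'b::{banach, second_countable_topology}"
  assumes "f \<in> borel_measurable M" "integrable M (\<lambda>x. (norm (f x))\<^sup>2)"
  shows "integrable M f"
proof -
  have "integrable M (\<lambda>x. norm (f x))"
    by (rule square_integrable_imp_integrable) (use assms in auto)
  then show ?thesis
    using assms(1) integrable_norm_iff by blast
qed

text \<open>Replacing \<open>H z\<close> by its centred version in the second factor subtracts the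
  outer product of \<open>H z - expect \<rho> H\<close> with a constant vector, whose expectation
  vanishes.\<close>

lemma expect_outer_centred:
  fixes H :: "real^'d \<Rightarrow> real^'n"
  assumes "prob_space \<rho>" and H: "H \<in> borel_measurable \<rho>"
    and H2: "integrable \<rho> (\<lambda>z. (norm (H z))\<^sup>2)"
  shows "integrable \<rho> (\<lambda>z. outer (H z - expect \<rho> H) (H z))"
    and "expect \<rho> (\<lambda>z. outer (H z - expect \<rho> H) (H z)) = cov \<rho> H"
proof -
  interpret prob_space \<rho> by fact
  interpret outer: bounded_bilinear "outer :: real^'n \<Rightarrow> real^'n \<Rightarrow> real^'n^'n"
    by (rule bounded_bilinear_outer)
  let ?b = "expect \<rho> H"
  have intH: "integrable \<rho> H"
    using H H2 by (rule integrable_of_square_integrable)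
  have const: "integrable \<rho> (\<lambda>z. outer ?b (H z))"
    using integrable_bounded_linear[OF outer.bounded_linear_right intH] .
  have const': "integrable \<rho> (\<lambda>z. outer (H z - ?b) ?b)"
    using integrable_bounded_linear[OF outer.bounded_linear_left, of \<rho> "\<lambda>z. H z - ?b" ?b] intH
    by simp
  \<comment> \<open>Splitting the first factor leaves a term controlled by second moments and one
    controlled by the first moment.\<close>
  show int: "integrable \<rho> (\<lambda>z. outer (H z - ?b) (H z))"
    using integrable_outer[OF H H H2 H2] const by (simp add: outer.diff_left)
  have "expect \<rho> (\<lambda>z. outer (H z - ?b) ?b) = outer (expect \<rho> (\<lambda>z. H z - ?b)) ?b"
    using integral_bounded_linear[OF outer.bounded_linear_left, of \<rho> "\<lambda>z. H z - ?b" ?b] intH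
    by (simp add: expect_def)
  also have "\<dots> = 0"
    using intH by (simp add: expect_def prob_space outer.zero_left)
  finally show "expect \<rho> (\<lambda>z. outer (H z - ?b) (H z)) = cov \<rho> H"
    \<comment> \<open>Only the second factor of the covariance is split; the first stays centred, so
      the subtracted term is the one just shown to vanish.\<close>
    using int const' by (simp add: cov_def outer.diff_right[of _ "H _"]) (simp add: expect_def)
qed

text \<open>Keeping the degree \<open>n\<close> general lets one argument serve both observation
  functions. Integrability is a separate conclusion because the integral of a non-integrable
  function is 0 by convention, so the equation alone would not assert that the expectation
  exists.\<close>

lemma gain_equation:
  fixes H :: "real^'d \<Rightarrow> real^'n"
  assumes "prob_space \<rho>" and sets: "sets \<rho> = sets borel"
    and "transpose \<Gamma> = \<Gamma>" "invertible \<Gamma>"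
    and diff: "\<And>z. H differentiable (at z)"
    and "\<And>t z. H (t *\<^sub>R z) = t ^ n *\<^sub>R H z"
    and "c * real n = 1"
    and "integrable \<rho> (\<lambda>z. (norm (H z))\<^sup>2)"
  shows "integrable \<rho> (\<lambda>z. transpose (gain c \<rho> H \<Gamma> z) ** grad H z)"
    and "expect \<rho> (\<lambda>z. transpose (gain c \<rho> H \<Gamma> z) ** grad H z) = inv_sq \<Gamma> ** cov \<rho> H"
proof -
  have "continuous_on UNIV H"
    using diff by (simp add: continuous_on_eq_continuous_at differentiable_imp_continuous_within)
  then have "H \<in> borel_measurable \<rho>"
    using borel_measurable_continuous_onI measurable_cong_sets[OF sets refl] by blast
  note centred = expect_outer_centred[OF \<open>prob_space \<rho>\<close> this assms(8)]
  have eq: "(\<lambda>z. transpose (gain c \<rho> H \<Gamma> z) ** grad H z)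
      = (\<lambda>z. inv_sq \<Gamma> ** outer (H z - expect \<rho> H) (H z))"
    using transpose_gain_grad[OF assms(3,4) diff assms(6,7)] by blast
  show "integrable \<rho> (\<lambda>z. transpose (gain c \<rho> H \<Gamma> z) ** grad H z)"
    unfolding eq by (rule integrable_bounded_linear[OF bounded_linear_matrix_mult centred(1)])
  show "expect \<rho> (\<lambda>z. transpose (gain c \<rho> H \<Gamma> z) ** grad H z) = inv_sq \<Gamma> ** cov \<rho> H"
    unfolding eq centred(2)[symmetric]
    using integral_bounded_linear[OF bounded_linear_matrix_mult centred(1)]
    by (simp add: expect_def)
qed

text \<open>A vector is the sum of its coordinates times fixed basis vectors, which reduces the
  claim to sums and scalings.\<close>

lemma differentiable_vec_lambda:
  fixes f :: "'n::finite \<Rightarrow> 'a::real_normed_vector \<Rightarrow> real"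
  assumes "\<And>k. f k differentiable (at z)"
  shows "(\<lambda>z. \<chi> k. f k z) differentiable (at z)"
proof -
  have eq: "(\<lambda>z. \<chi> k. f k z) = (\<lambda>z. \<Sum>k\<in>UNIV. f k z *\<^sub>R axis k 1)"
    by (auto simp: fun_eq_iff vec_eq_iff axis_def if_distrib cong: if_cong)
  show ?thesis
    unfolding eq using assms by (intro differentiable_sum differentiable_scaleR) auto
qed

lemma differentiable_vec_nth: "(\<lambda>z::real^'d. z $ j) differentiable (at z)"
  by (intro linear_imp_differentiable linearI) auto

lemma differentiable_obs_mean: "obs_mean B v e differentiable (at z)"
  unfolding obs_mean_def
  by (intro differentiable_vec_lambda differentiable_sum finite ballI differentiable_mult
      differentiable_vec_nth differentiable_const)

lemma differentiable_obs_var: "obs_var B v e differentiable (at z)"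
  unfolding obs_var_def
  by (intro differentiable_vec_lambda differentiable_sum finite ballI differentiable_add
      differentiable_mult differentiable_vec_nth differentiable_const)

lemma obs_mean_scaleR: "obs_mean B v e (t *\<^sub>R z) = t ^ 2 *\<^sub>R obs_mean B v e z"
  by (simp add: obs_mean_def vec_eq_iff sum_distrib_left power2_eq_square mult_ac)

lemma obs_var_scaleR: "obs_var B v e (t *\<^sub>R z) = t ^ 3 *\<^sub>R obs_var B v e z"
  by (simp add: obs_var_def vec_eq_iff sum_distrib_left power3_eq_cube distrib_left mult_ac)

theorem proposition2:
  fixes B :: "real^'d \<Rightarrow> real^'d \<Rightarrow> real^'d"
    and v :: "'d::finite \<Rightarrow> real^'d"
    and e :: "'s::finite \<Rightarrow> 'd"
    and \<Gamma>m :: "real^'s^'s"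
    and \<Gamma>v :: "real^('s \<times> 's)^('s \<times> 's)"
    and M :: "'w measure"
    and Z :: "'w \<Rightarrow> real^'d"
    and \<rho> :: "(real^'d) measure"
    and Hm :: "real^'d \<Rightarrow> real^'s"
    and Hv :: "real^'d \<Rightarrow> real^('s \<times> 's)"
    and Km :: "real^'d \<Rightarrow> real^'s^'d"
    and Kv :: "real^'d \<Rightarrow> real^('s \<times> 's)^'d"
  assumes "inj e"
    and "orthonormal_basis v"
    and "bilinear B"
    and "\<And>u. u \<bullet> B u u = 0"
    and "transpose \<Gamma>m = \<Gamma>m" and "invertible \<Gamma>m"
    and "transpose \<Gamma>v = \<Gamma>v" and "invertible \<Gamma>v"
    and "prob_space M" and "Z \<in> borel_measurable M"
    and "\<rho> = distr M borel Z"
    and "Hm = obs_mean B v e"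
    and "Hv = obs_var B v e"
    and "integrable \<rho> (\<lambda>z. (norm (Hm z))\<^sup>2)"
    and "integrable \<rho> (\<lambda>z. (norm (Hv z))\<^sup>2)"
    and "Km = gain (1/2) \<rho> Hm \<Gamma>m"
    and "Kv = gain (1/3) \<rho> Hv \<Gamma>v"
  shows "(integrable \<rho> (\<lambda>z. transpose (Km z) ** grad Hm z) \<and>
          expect \<rho> (\<lambda>z. transpose (Km z) ** grad Hm z) = inv_sq \<Gamma>m ** cov \<rho> Hm) \<and>
         (integrable \<rho> (\<lambda>z. transpose (Kv z) ** grad Hv z) \<and>
          expect \<rho> (\<lambda>z. transpose (Kv z) ** grad Hv z) = inv_sq \<Gamma>v ** cov \<rho> Hv)"
proof -
  interpret M: prob_space M by fact
  have \<rho>: "prob_space \<rho>" "sets \<rho> = sets borel"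
    using M.prob_space_distr[of Z borel] assms(10,11) by simp_all
  \<comment> \<open>The factors 1/2 and 1/3 in the gains are the reciprocals of the degrees of
    homogeneity, 2 for \<open>Hm\<close> and 3 for \<open>Hv\<close>.\<close>
  have "(1/2) * real 2 = 1" "(1/3) * real 3 = 1" by simp_all
  then show ?thesis
    using gain_equation[OF \<rho> assms(5,6) differentiable_obs_mean obs_mean_scaleR, of "1/2" B v e]
      gain_equation[OF \<rho> assms(7,8) differentiable_obs_var obs_var_scaleR, of "1/3" B v e]
      assms(12-17) by simp
qed

end
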